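(* Let $n\ge 2$ be an integer, let $\alpha\in(0,1/(n-1))$, and let $f(x)=\frac12x^TAx$ on $\mathbb{R}^n$ with Hessian matrix $A=(1+\alpha)I-\alpha\mathbf{1}\mathbf{1}^T$. Let $\mu=1-\alpha(n-1)$ and let $x^*=0$ be the minimizer of $f$. Then, for any initial point $x^0\in\mathbb{R}^n$ and every integer $k\ge 0$, the RCD iterates $x_{\mathrm{RCD}}^k$ started from $x^0$ satisfy $$\mathbb{E}\,\|x_{\mathrm{RCD}}^{k}-x^*\|^2\le\left(1-\frac{2\mu}{n}+\frac{\mu^2}{n}\right)^{k}\|x^0-x^*\|^2$$ and $$\mathbb{E}\left(f(x_{\mathrm{RCD}}^{k})-f(x^* )\right)\le\left(1-\frac{\mu}{n}\right)^{k}\left(f(x^0)-f(x^* )\right).$$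
   Context: $\mathbf{1}\in\mathbb{R}^n$ is the all-ones vector, $e_i$ is the $i$-th standard basis vector, and $\|\cdot\|$ is the Euclidean norm. RCD (randomized coordinate descent with exact line search): $x_{\mathrm{RCD}}^0=x^0$ is deterministic, and for $k\ge0$ the update is $$x_{\mathrm{RCD}}^{k+1}=\left(I-\frac{1}{A_{i_ki_k}}e_{i_k}e_{i_k}^TA\right)x_{\mathrm{RCD}}^{k},$$ where the indices $i_0,i_1,\dots$ are independent and uniformly distributed on $\{1,\dots,n\}$ (here $A_{ii}=1$ for all $i$). The number $\mu$ is the smallest eigenvalue of $A$. $\mathbb{E}$ is expectation over all random indices. *)

theory Defs
  imports "HOL-Probability.Probability"
begin

definition outer :: "real ^ 'm \<Rightarrow> real ^ 'n \<Rightarrow> real ^ 'n ^ 'm"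
  where "outer u v = (\<chi> i j. u $ i * v $ j)"

definition hessian :: "real \<Rightarrow> real ^ 'n ^ 'n"
  where "hessian \<alpha> = (1 + \<alpha>) *\<^sub>R mat 1 - \<alpha> *\<^sub>R outer 1 1"

definition quad :: "real ^ 'n ^ 'n \<Rightarrow> real ^ 'n \<Rightarrow> real"
  where "quad A x = 1 / 2 * (x \<bullet> (A *v x))"

definition rcd_step :: "real ^ 'n ^ 'n \<Rightarrow> 'n \<Rightarrow> real ^ 'n \<Rightarrow> real ^ 'n"
  where "rcd_step A i x =
    (mat 1 - (1 / A $ i $ i) *\<^sub>R (outer (axis i 1) (axis i 1) ** A)) *v x"

primrec rcd :: "real ^ 'n ^ 'n \<Rightarrow> real ^ 'n \<Rightarrow> (nat \<Rightarrow> 'n) \<Rightarrow> nat \<Rightarrow> real ^ 'n"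
  where
    "rcd A x0 idx 0 = x0"
  | "rcd A x0 idx (Suc k) = rcd_step A (idx k) (rcd A x0 idx k)"

lemma hessian_diag: "hessian \<alpha> $ i $ i = 1"
  by (simp add: hessian_def outer_def mat_def)

lemma hessian_mult_nth:
  fixes x :: "real ^ 'n"
  shows "(hessian \<alpha> *v x) $ i = (1 + \<alpha>) * x $ i - \<alpha> * (\<Sum>j\<in>UNIV. x $ j)"
proof -
  have "(hessian \<alpha> *v x) $ i
      = (\<Sum>j\<in>UNIV. (if i = j then (1 + \<alpha>) * x $ j else 0) - \<alpha> * x $ j)"
    unfolding matrix_vector_mult_def
    by (auto simp: hessian_def outer_def mat_def algebra_simps intro!: sum.cong)
  also have "\<dots> = (1 + \<alpha>) * x $ i - \<alpha> * (\<Sum>j\<in>UNIV. x $ j)"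
    by (simp add: sum_subtractf sum_distrib_left)
  finally show ?thesis .
qed

lemma hessian_least_eigenvalue:
  fixes \<alpha> \<mu> :: real
  assumes "0 < \<alpha>" and "\<mu> = 1 - \<alpha> * (real CARD('n) - 1)"
  shows "\<exists>v. v \<noteq> 0 \<and> hessian \<alpha> *v v = \<mu> *\<^sub>R (v :: real ^ 'n)"
    and "\<And>c v. v \<noteq> 0 \<Longrightarrow> hessian \<alpha> *v v = c *\<^sub>R (v :: real ^ 'n) \<Longrightarrow> \<mu> \<le> c"
proof -
  have "hessian \<alpha> *v 1 = \<mu> *\<^sub>R (1 :: real ^ 'n)"
    by (simp add: vec_eq_iff hessian_mult_nth assms algebra_simps)
  moreover have "(1 :: real ^ 'n) \<noteq> 0"
    by simp
  ultimately show "\<exists>v. v \<noteq> 0 \<and> hessian \<alpha> *v v = \<mu> *\<^sub>R (v :: real ^ 'n)"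
    by blast
next
  fix c and v :: "real ^ 'n"
  assume v: "v \<noteq> 0" and ev: "hessian \<alpha> *v v = c *\<^sub>R v"
  define s where "s = (\<Sum>j\<in>UNIV. v $ j)"
  have eq: "(1 + \<alpha>) * v $ i - \<alpha> * s = c * v $ i" for i
    using arg_cong[OF ev, of "\<lambda>w. w $ i"] by (simp add: hessian_mult_nth s_def)
  show "\<mu> \<le> c"
  proof (cases "s = 0")
    case True
    obtain i where "v $ i \<noteq> 0"
      using v by (auto simp: vec_eq_iff)
    then have "c = 1 + \<alpha>"
      using eq[of i] True by simp
    moreover have "0 \<le> \<alpha> * real CARD('n)"
      using assms(1) by simp
    ultimately show ?thesis
      by (simp add: assms(2) algebra_simps)
  next
    case False
    have "(\<Sum>i\<in>(UNIV :: 'n set). (1 + \<alpha>) * v $ i - \<alpha> * s) = (\<Sum>i\<in>UNIV. c * v $ i)"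
      by (simp add: eq)
    then have "(1 + \<alpha>) * s - real CARD('n) * (\<alpha> * s) = c * s"
      by (simp add: sum_subtractf s_def flip: sum_distrib_left)
    then have "\<mu> * s = c * s"
      by (simp add: assms(2) algebra_simps)
    then show ?thesis
      using False by simp
  qed
qed

lemma quad_hessian_unique_minimizer:
  fixes x :: "real ^ 'n"
  assumes "0 < \<alpha>" and "\<alpha> * (real CARD('n) - 1) < 1" and "x \<noteq> 0"
  shows "quad (hessian \<alpha>) 0 < quad (hessian \<alpha>) x"
proof -
  define s where "s = (\<Sum>j\<in>UNIV. x $ j)"
  have "s = 1 \<bullet> x"
    by (simp add: s_def inner_vec_def)
  then have "s\<^sup>2 \<le> (1 \<bullet> (1 :: real ^ 'n)) * (x \<bullet> x)"
    using Cauchy_Schwarz_ineq by metis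
  then have "s\<^sup>2 \<le> real CARD('n) * (x \<bullet> x)"
    by (simp add: inner_vec_def)
  then have "\<alpha> * s\<^sup>2 \<le> \<alpha> * (real CARD('n) * (x \<bullet> x))"
    using assms(1) by simp
  moreover have "0 < (1 - \<alpha> * (real CARD('n) - 1)) * (x \<bullet> x)"
    using assms by simp
  moreover have "x \<bullet> (hessian \<alpha> *v x) = (1 + \<alpha>) * (x \<bullet> x) - \<alpha> * s\<^sup>2"
    by (simp add: inner_vec_def hessian_mult_nth s_def[symmetric] right_diff_distrib
        sum_subtractf power2_eq_square sum_distrib_left mult.assoc mult.left_commute)
       (simp add: s_def sum_distrib_left sum_distrib_right mult_ac)
  ultimately show ?thesis
    by (simp add: quad_def algebra_simps)
qed

(* Each iterate takes finitely many values, so the Bochner integrals used as expectations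
   of functions of the iterates are never the default value 0. *)
lemma integrable_rcd:
  fixes I :: "nat \<Rightarrow> 'w \<Rightarrow> 'n::finite" and g :: "real ^ 'n \<Rightarrow> real"
  assumes "prob_space M" and I: "\<And>k. I k \<in> measurable M (count_space UNIV)"
  shows "integrable M (\<lambda>\<omega>. g (rcd A x0 (\<lambda>j. I j \<omega>) k))"
proof -
  interpret prob_space M by fact
  have "simple_function M (I j)" for j
    using I[of j] by (auto simp: simple_function_def intro: measurable_sets)
  then have "simple_function M (\<lambda>\<omega>. rcd A x0 (\<lambda>j. I j \<omega>) k)"
    by (induction k) (auto intro: simple_function_compose2)
  then have sf: "simple_function M (\<lambda>\<omega>. g (rcd A x0 (\<lambda>j. I j \<omega>) k))"
    by (rule simple_function_compose1)
  have "Bochner_Integration.simple_bochner_integrable M (\<lambda>\<omega>. g (rcd A x0 (\<lambda>j. I j \<omega>) k))"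
    using sf by (auto intro!: simple_bochner_integrable.intros simp: emeasure_finite)
  then show ?thesis
    by (auto intro: integrableI_simple_bochner_integrable)
qed

end

theory Submission
  imports Defs
begin

text \<open>
  Write \<open>n\<close> for the dimension. Since the diagonal of \<open>A\<close> is 1, a step along coordinate \<open>i\<close>
  subtracts \<open>(A x)\<^sub>i\<close> from \<open>x\<^sub>i\<close>. Averaging over the \<open>n\<close> choices of \<open>i\<close> turns the squares of single
  gradient entries into full norms: the mean of the squared distance becomes
  \<open>\<parallel>x\<parallel>\<^sup>2 - (2 x \<bullet> A x - \<parallel>A x\<parallel>\<^sup>2) / n = (1 - 1 / n) \<parallel>x\<parallel>\<^sup>2 + \<parallel>x - A x\<parallel>\<^sup>2 / n\<close>,
  and the mean of the objective becomes \<open>f x - \<parallel>A x\<parallel>\<^sup>2 / (2 n)\<close>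
  (\<open>sum_norm_sq_rcd_step\<close>, \<open>sum_quad_rcd_step\<close>).

  The eigenvalues of \<open>A\<close> are \<open>\<mu> = 1 - \<alpha> (n - 1)\<close>, on the multiples of the all-ones vector, and
  \<open>1 + \<alpha>\<close>, on its orthogonal complement. Hence \<open>I - A\<close> has operator norm
  \<open>max (1 - \<mu>) \<alpha> = 1 - \<mu>\<close> when \<open>n \<ge> 2\<close>, and \<open>\<parallel>A x\<parallel>\<^sup>2 \<ge> \<mu> (x \<bullet> A x)\<close>. Both inequalities are
  obtained without diagonalising: they reduce to the Cauchy-Schwarz bound
  \<open>(\<Sum>j. x\<^sub>j)\<^sup>2 \<le> n \<parallel>x\<parallel>\<^sup>2\<close>
  (\<open>norm_sq_residual_hessian_le\<close>, \<open>gradient_domination_hessian\<close>).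
  Inserted in the two averages, they give one-step contraction by the claimed factors at every point.

  The \<open>k\<close>-th iterate depends on the first \<open>k\<close> indices only, so it is independent of the next index,
  and the expectation after one more step is the expectation of the average over \<open>i\<close>
  (\<open>expectation_rcd_Suc\<close>). The pointwise contraction therefore iterates to a factor
  \<open>c ^ k\<close> (\<open>expectation_rcd_le\<close>), which is applied once to the squared norm and once to \<open>f\<close>.
\<close>

section \<open>One coordinate step\<close>

lemma outer_mult_vector:
  "outer u v *v y = (v \<bullet> y) *\<^sub>R u"
  by (simp add: vec_eq_iff outer_def matrix_vector_mult_def inner_vec_def sum_distrib_left
      sum_distrib_right mult_ac)

lemma rcd_step_eq:
  "rcd_step A i x = x - axis i ((A *v x) $ i / A $ i $ i)"
proof -
  have "((outer (axis i 1) (axis i 1) ** A) *v x) = axis i ((A *v x) $ i)"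
    by (simp add: matrix_vector_mul_assoc[symmetric] outer_mult_vector inner_axis')
      (simp add: vec_eq_iff axis_def)
  then show ?thesis
    by (simp add: rcd_step_def matrix_vector_mult_diff_rdistrib scaleR_matrix_vector_assoc[symmetric])
      (simp add: vec_eq_iff axis_def)
qed

lemma sum_norm_sq_rcd_step:
  fixes A :: "real ^ 'n ^ 'n"
  assumes "\<And>i. A $ i $ i = 1"
  shows "(\<Sum>i\<in>UNIV. (norm (rcd_step A i x))\<^sup>2)
    = real CARD('n) * (norm x)\<^sup>2 - 2 * (x \<bullet> (A *v x)) + (norm (A *v x))\<^sup>2"
proof -
  have "(norm (rcd_step A i x))\<^sup>2
      = (norm x)\<^sup>2 - 2 * (x $ i * (A *v x) $ i) + (A *v x) $ i * (A *v x) $ i" for i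
    by (simp add: rcd_step_eq assms power2_norm_eq_inner inner_diff_left inner_diff_right
        inner_axis inner_axis' algebra_simps)
  then show ?thesis
    by (simp add: sum.distrib sum_subtractf flip: sum_distrib_left)
      (simp add: power2_norm_eq_inner inner_vec_def)
qed

text \<open>Exact line search along coordinate \<open>i\<close> gains half the squared gradient entry: the linear
  term of the expansion at \<open>x\<close> loses the whole square, and the quadratic term, with \<open>A\<^sub>i\<^sub>i = 1\<close>,
  gives half of it back. Symmetry makes \<open>A x\<close> the gradient.\<close>

lemma quad_rcd_step:
  fixes A :: "real ^ 'n ^ 'n"
  assumes "transpose A = A" and "A $ i $ i = 1"
  shows "quad A (rcd_step A i x) = quad A x - ((A *v x) $ i)\<^sup>2 / 2"
proof -
  have sym: "u \<bullet> (A *v v) = v \<bullet> (A *v u)" for u v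
    by (metis assms(1) dot_lmul_matrix inner_commute transpose_matrix_vector)
  have "(A *v axis i t) $ i = t" for t
    by (simp add: matrix_vector_mult_def axis_def assms(2) if_distrib cong: if_cong)
  then show ?thesis
    by (simp add: quad_def rcd_step_eq assms(2) matrix_vector_mult_diff_distrib inner_diff_left
        inner_diff_right sym[of x "axis _ _"] inner_axis' power2_eq_square algebra_simps)
qed

lemma sum_quad_rcd_step:
  fixes A :: "real ^ 'n ^ 'n"
  assumes "transpose A = A" and "\<And>i. A $ i $ i = 1"
  shows "(\<Sum>i\<in>UNIV. quad A (rcd_step A i x)) = real CARD('n) * quad A x - (norm (A *v x))\<^sup>2 / 2"
  by (simp add: quad_rcd_step assms sum_subtractf flip: sum_divide_distrib)
    (unfold power2_norm_eq_inner, simp add: inner_vec_def power2_eq_square)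

section \<open>Spectral inequalities for the Hessian\<close>

lemma transpose_hessian: "transpose (hessian \<alpha>) = hessian \<alpha>"
  by (simp add: vec_eq_iff transpose_def hessian_def outer_def mat_def)

lemma sum_sq_le_card_norm_sq:
  fixes x :: "real ^ 'n"
  shows "(\<Sum>j\<in>UNIV. x $ j)\<^sup>2 \<le> real CARD('n) * (norm x)\<^sup>2"
  using Cauchy_Schwarz_ineq[of 1 x] by (simp add: power2_norm_eq_inner inner_vec_def)

lemma hessian_mult_eq:
  fixes x :: "real ^ 'n"
  shows "hessian \<alpha> *v x = (1 + \<alpha>) *\<^sub>R x - (\<alpha> * (\<Sum>j\<in>UNIV. x $ j)) *\<^sub>R 1"
  by (simp add: vec_eq_iff hessian_mult_nth)

text \<open>This is the bound \<open>1 - \<mu>\<close> on the operator norm of \<open>I - A = \<alpha> (1 1\<^sup>T - I)\<close>, whose eigenvalues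
  are \<open>\<alpha> (n - 1)\<close> and \<open>- \<alpha>\<close>. With \<open>s = \<Sum>j. x\<^sub>j\<close> the squared norm is
  \<open>\<alpha>\<^sup>2 (\<parallel>x\<parallel>\<^sup>2 + (n - 2) s\<^sup>2)\<close>; the hypothesis makes the coefficient of \<open>s\<^sup>2\<close> nonnegative, so that the
  upper bound on \<open>s\<^sup>2\<close> may be inserted.\<close>

lemma norm_sq_residual_hessian_le:
  fixes x :: "real ^ 'n"
  assumes "2 \<le> CARD('n)"
  shows "(norm (x - hessian \<alpha> *v x))\<^sup>2 \<le> (\<alpha> * (real CARD('n) - 1))\<^sup>2 * (norm x)\<^sup>2"
proof -
  define s where "s = (\<Sum>j\<in>UNIV. x $ j)"
  have s: "x \<bullet> 1 = s" "1 \<bullet> x = s" "(1 :: real ^ 'n) \<bullet> 1 = real CARD('n)"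
    by (simp_all add: s_def inner_vec_def)
  have "x - hessian \<alpha> *v x = \<alpha> *\<^sub>R (s *\<^sub>R 1 - x)"
    by (simp add: hessian_mult_eq s_def[symmetric] algebra_simps)
  then have "(norm (x - hessian \<alpha> *v x))\<^sup>2 = \<alpha>\<^sup>2 * (norm (s *\<^sub>R 1 - x))\<^sup>2"
    by (simp add: power_mult_distrib)
  also have "(norm (s *\<^sub>R 1 - x))\<^sup>2 = (norm x)\<^sup>2 + (real CARD('n) - 2) * s\<^sup>2"
    unfolding power2_norm_eq_inner
    by (simp add: inner_diff_left inner_diff_right s power2_eq_square algebra_simps)
  also have "\<dots> \<le> (norm x)\<^sup>2 + (real CARD('n) - 2) * (real CARD('n) * (norm x)\<^sup>2)"
    using assms sum_sq_le_card_norm_sq[of x] by (intro add_left_mono mult_left_mono) (auto simp: s_def)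
  also have "\<dots> = (real CARD('n) - 1)\<^sup>2 * (norm x)\<^sup>2"
    by (simp add: power2_eq_square algebra_simps)
  finally show ?thesis
    by (simp add: power_mult_distrib mult_left_mono)
qed

text \<open>A Polyak-Lojasiewicz inequality: each eigenvalue satisfies \<open>\<lambda>\<^sup>2 \<ge> \<mu> \<lambda>\<close>. The difference of the two
  sides vanishes along the all-ones vector, an eigenvector for \<open>\<mu>\<close>, as does the
  Cauchy-Schwarz defect \<open>n \<parallel>x\<parallel>\<^sup>2 - s\<^sup>2\<close>, with \<open>s\<close> the sum of the entries; on the orthogonal
  complement both are multiples of \<open>\<parallel>x\<parallel>\<^sup>2\<close>, in the ratio \<open>\<alpha> (1 + \<alpha>)\<close>.\<close>

lemma gradient_domination_hessian:
  fixes x :: "real ^ 'n"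
  assumes "0 \<le> \<alpha>"
  shows "(1 - \<alpha> * (real CARD('n) - 1)) * (x \<bullet> (hessian \<alpha> *v x)) \<le> (norm (hessian \<alpha> *v x))\<^sup>2"
proof -
  define s where "s = (\<Sum>j\<in>UNIV. x $ j)"
  have s: "x \<bullet> 1 = s" "1 \<bullet> x = s" "(1 :: real ^ 'n) \<bullet> 1 = real CARD('n)"
    by (simp_all add: s_def inner_vec_def)
  have "(norm (hessian \<alpha> *v x))\<^sup>2 - (1 - \<alpha> * (real CARD('n) - 1)) * (x \<bullet> (hessian \<alpha> *v x))
      = \<alpha> * (1 + \<alpha>) * (real CARD('n) * (norm x)\<^sup>2 - s\<^sup>2)"
    unfolding power2_norm_eq_inner
    by (simp add: hessian_mult_eq s_def[symmetric] inner_diff_left inner_diff_right s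
        power2_eq_square algebra_simps)
  also have "\<dots> \<ge> 0"
    using assms sum_sq_le_card_norm_sq[of x] by (intro mult_nonneg_nonneg) (auto simp: s_def)
  finally show ?thesis
    by simp
qed

section \<open>Taking expectations\<close>

lemma rcd_cong:
  assumes "\<And>j. j < k \<Longrightarrow> idx j = idx' j"
  shows "rcd A x0 idx k = rcd A x0 idx' k"
  using assms by (induction k) auto

text \<open>The target is the discrete space on all vectors, so that the iterate may be composed with an
  arbitrary real function. This is possible because the index type is finite: the update is then a
  countable case distinction on the index.\<close>

lemma measurable_rcd:
  fixes A :: "real ^ 'n ^ 'n"
  assumes "{..<k} \<subseteq> J"
  shows "(\<lambda>idx. rcd A x0 idx k) \<in> measurable (PiM J (\<lambda>_. count_space UNIV)) (count_space UNIV)"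
  using assms
proof (induction k)
  case (Suc k)
  have IH: "(\<lambda>idx. rcd A x0 idx k) \<in> measurable (PiM J (\<lambda>_. count_space UNIV)) (count_space UNIV)"
    using Suc.prems by (intro Suc.IH) auto
  have comp: "(\<lambda>idx. idx k) \<in> measurable (PiM J (\<lambda>_. count_space UNIV)) (count_space (UNIV :: 'n set))"
    using Suc.prems by (intro measurable_component_singleton) auto
  have "(\<lambda>idx. rcd_step A i (rcd A x0 idx k))
      \<in> measurable (PiM J (\<lambda>_. count_space UNIV)) (count_space UNIV)" for i
    using measurable_compose[OF IH, of "rcd_step A i"] by simp
  then show ?case
    using comp unfolding rcd.simps by (rule measurable_compose_countable)
qed simp

text \<open>The two sides are functions of disjoint blocks of the independent family, the index \<open>k\<close> alone
  and the indices below \<open>k\<close>.\<close>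

lemma (in prob_space) indep_var_rcd_index:
  fixes I :: "nat \<Rightarrow> 'a \<Rightarrow> 'n::finite" and g :: "real ^ 'n \<Rightarrow> real" and h :: "'n \<Rightarrow> real"
  assumes "indep_vars (\<lambda>_. count_space UNIV) I UNIV"
  shows "indep_var borel (\<lambda>\<omega>. h (I k \<omega>)) borel (\<lambda>\<omega>. g (rcd A x0 (\<lambda>j. I j \<omega>) k))"
proof -
  have "indep_var (PiM {k} (\<lambda>_. count_space UNIV)) (\<lambda>\<omega>. restrict (\<lambda>j. I j \<omega>) {k})
      (PiM {..<k} (\<lambda>_. count_space UNIV)) (\<lambda>\<omega>. restrict (\<lambda>j. I j \<omega>) {..<k})"
    using assms by (rule indep_var_restrict) auto
  then have "indep_var borel ((\<lambda>idx. h (idx k)) \<circ> (\<lambda>\<omega>. restrict (\<lambda>j. I j \<omega>) {k}))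
      borel ((\<lambda>idx. g (rcd A x0 idx k)) \<circ> (\<lambda>\<omega>. restrict (\<lambda>j. I j \<omega>) {..<k}))"
  proof (rule indep_var_compose)
    have "(\<lambda>idx. idx k) \<in> measurable (PiM {k} (\<lambda>_. count_space UNIV)) (count_space (UNIV :: 'n set))"
      by (intro measurable_component_singleton) auto
    then show "(\<lambda>idx. h (idx k)) \<in> measurable (PiM {k} (\<lambda>_. count_space UNIV)) borel"
      by (rule measurable_compose) simp
    show "(\<lambda>idx. g (rcd A x0 idx k)) \<in> measurable (PiM {..<k} (\<lambda>_. count_space UNIV)) borel"
      by (rule measurable_compose[OF measurable_rcd]) auto
  qed
  moreover have "rcd A x0 (restrict (\<lambda>j. I j \<omega>) {..<k}) k = rcd A x0 (\<lambda>j. I j \<omega>) k" for \<omega>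
    by (rule rcd_cong) simp
  ultimately show ?thesis
    by (simp add: comp_def)
qed

lemma (in prob_space) expectation_indicator_uniform_index:
  fixes X :: "'a \<Rightarrow> 'n::finite"
  assumes "X \<in> measurable M (count_space UNIV)"
    and "distr M (count_space UNIV) X = uniform_count_measure UNIV"
  shows "expectation (\<lambda>\<omega>. indicator {i} (X \<omega>) :: real) = 1 / real CARD('n)"
proof -
  have "expectation (\<lambda>\<omega>. indicator {i} (X \<omega>) :: real)
      = integral\<^sup>L (distr M (count_space UNIV) X) (indicator {i})"
    using assms(1) by (rule integral_distr[symmetric]) simp
  also have "\<dots> = 1 / real CARD('n)"
    unfolding assms(2) by (simp add: measure_uniform_count_measure)
  finally show ?thesis .
qed

text \<open>The tower property for the next index, in elementary form: splitting according to the value of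
  \<open>I k\<close> writes the new value as a sum over \<open>i\<close> of the indicator of \<open>I k = i\<close> times a function of the
  current iterate. The factors of each summand are independent and the indicator has mean
  \<open>1 / n\<close>.\<close>

lemma (in prob_space) expectation_rcd_Suc:
  fixes I :: "nat \<Rightarrow> 'a \<Rightarrow> 'n::finite" and g :: "real ^ 'n \<Rightarrow> real"
  assumes indep: "indep_vars (\<lambda>_. count_space UNIV) I UNIV"
    and unif: "\<And>j. distr M (count_space UNIV) (I j) = uniform_count_measure UNIV"
  shows "expectation (\<lambda>\<omega>. g (rcd A x0 (\<lambda>j. I j \<omega>) (Suc k)))
    = expectation (\<lambda>\<omega>. (\<Sum>i\<in>UNIV. g (rcd_step A i (rcd A x0 (\<lambda>j. I j \<omega>) k))) / real CARD('n))"
proof -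
  let ?X = "\<lambda>\<omega>. rcd A x0 (\<lambda>j. I j \<omega>) k"
  let ?g = "\<lambda>i x. g (rcd_step A i x)"
  have meas: "I j \<in> measurable M (count_space UNIV)" for j
    using indep by (auto simp: indep_vars_def)
  have intg: "integrable M (\<lambda>\<omega>. ?g i (?X \<omega>))" for i
    by (rule integrable_rcd[where g = "?g i"]) (use meas prob_space_axioms in auto)
  have intI: "integrable M (\<lambda>\<omega>. indicator {i} (I k \<omega>) :: real)" for i
  proof (rule integrable_const_bound[where B = 1])
    show "(\<lambda>\<omega>. indicator {i} (I k \<omega>) :: real) \<in> borel_measurable M"
      using meas by (rule measurable_compose) simp
  qed simp
  have ind: "indep_var borel (\<lambda>\<omega>. indicator {i} (I k \<omega>)) borel (\<lambda>\<omega>. ?g i (?X \<omega>))" for i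
    using indep by (rule indep_var_rcd_index)
  have "expectation (\<lambda>\<omega>. g (rcd A x0 (\<lambda>j. I j \<omega>) (Suc k)))
      = expectation (\<lambda>\<omega>. \<Sum>i\<in>UNIV. indicator {i} (I k \<omega>) * ?g i (?X \<omega>))"
    by (simp add: indicator_def)
  also have "\<dots> = (\<Sum>i\<in>UNIV. expectation (\<lambda>\<omega>. indicator {i} (I k \<omega>) * ?g i (?X \<omega>)))"
    using indep_var_integrable[OF ind intI intg] by (rule Bochner_Integration.integral_sum)
  also have "\<dots> = (\<Sum>i\<in>UNIV. expectation (\<lambda>\<omega>. ?g i (?X \<omega>)) / real CARD('n))"
    by (simp add: indep_var_lebesgue_integral[OF ind intI intg]
        expectation_indicator_uniform_index[OF meas unif])
  also have "\<dots> = expectation (\<lambda>\<omega>. (\<Sum>i\<in>UNIV. ?g i (?X \<omega>)) / real CARD('n))"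
    using intg by (simp add: Bochner_Integration.integral_sum sum_divide_distrib)
  finally show ?thesis .
qed

lemma (in prob_space) expectation_rcd_le:
  fixes I :: "nat \<Rightarrow> 'a \<Rightarrow> 'n::finite" and g :: "real ^ 'n \<Rightarrow> real"
  assumes indep: "indep_vars (\<lambda>_. count_space UNIV) I UNIV"
    and unif: "\<And>j. distr M (count_space UNIV) (I j) = uniform_count_measure UNIV"
    and "0 \<le> c"
    and contr: "\<And>x. (\<Sum>i\<in>UNIV. g (rcd_step A i x)) / real CARD('n) \<le> c * g x"
  shows "expectation (\<lambda>\<omega>. g (rcd A x0 (\<lambda>j. I j \<omega>) k)) \<le> c ^ k * g x0"
proof (induction k)
  case 0
  then show ?case
    by (simp add: prob_space)
next
  case (Suc k)
  let ?X = "\<lambda>\<omega>. rcd A x0 (\<lambda>j. I j \<omega>) k"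
  have int: "integrable M (\<lambda>\<omega>. h (?X \<omega>))" for h :: "real ^ 'n \<Rightarrow> real"
    by (rule integrable_rcd) (use indep prob_space_axioms in \<open>auto simp: indep_vars_def\<close>)
  have "expectation (\<lambda>\<omega>. g (rcd A x0 (\<lambda>j. I j \<omega>) (Suc k)))
      = expectation (\<lambda>\<omega>. (\<Sum>i\<in>UNIV. g (rcd_step A i (?X \<omega>))) / real CARD('n))"
    using indep unif by (rule expectation_rcd_Suc)
  also have "\<dots> \<le> expectation (\<lambda>\<omega>. c * g (?X \<omega>))"
    using int[of "\<lambda>x. (\<Sum>i\<in>UNIV. g (rcd_step A i x)) / real CARD('n)"] int[of "\<lambda>x. c * g x"] contr
    by (intro integral_mono) auto
  also have "\<dots> \<le> c ^ Suc k * g x0"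
    using mult_left_mono[OF Suc.IH \<open>0 \<le> c\<close>] by simp
  finally show ?case .
qed

theorem proposition4p5:
  fixes \<alpha> \<mu> :: real
    and A :: "real ^ 'n ^ 'n"
    and f :: "real ^ 'n \<Rightarrow> real"
    and xstar x0 :: "real ^ 'n"
    and M :: "'w measure"
    and I :: "nat \<Rightarrow> 'w \<Rightarrow> 'n::finite"
    and k :: nat
  assumes "2 \<le> CARD('n)"
    and "0 < \<alpha>" and "\<alpha> < 1 / (real CARD('n) - 1)"
    and "A = hessian \<alpha>"
    and "f = quad A"
    and "\<mu> = 1 - \<alpha> * (real CARD('n) - 1)"
    and "xstar = 0"
    and "prob_space M"
    and "prob_space.indep_vars M (\<lambda>_. count_space UNIV) I UNIV"
    and "\<And>j. distr M (count_space UNIV) (I j) = uniform_count_measure UNIV"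
  shows "prob_space.expectation M (\<lambda>\<omega>. (norm (rcd A x0 (\<lambda>j. I j \<omega>) k - xstar))\<^sup>2)
           \<le> (1 - 2 * \<mu> / real CARD('n) + \<mu>\<^sup>2 / real CARD('n)) ^ k * (norm (x0 - xstar))\<^sup>2
         \<and> prob_space.expectation M (\<lambda>\<omega>. f (rcd A x0 (\<lambda>j. I j \<omega>) k) - f xstar)
           \<le> (1 - \<mu> / real CARD('n)) ^ k * (f x0 - f xstar)"
proof -
  interpret prob_space M by fact
  have n: "real CARD('n) - 1 > 0" "real CARD('n) > 0"
    using assms(1) by linarith+
  have \<mu>: "\<mu> < 1"
    using assms(2,6) n by simp
  \<comment> \<open>The iteration needs nonnegative factors; the first is \<open>1 - 1 / n + (1 - \<mu>)\<^sup>2 / n\<close>.\<close>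
  have "0 \<le> (1 - \<mu>)\<^sup>2 / real CARD('n) + (1 - 1 / real CARD('n))"
    using n by simp
  then have rate1: "0 \<le> 1 - 2 * \<mu> / real CARD('n) + \<mu>\<^sup>2 / real CARD('n)"
    by (simp add: power2_diff add_divide_distrib diff_divide_distrib)
  have "\<mu> \<le> real CARD('n)"
    using n \<mu> by linarith
  then have rate2: "0 \<le> 1 - \<mu> / real CARD('n)"
    using n by simp
  have diag: "hessian \<alpha> $ i $ i = 1" for i :: 'n
    by (rule hessian_diag)
  have step1: "(\<Sum>i\<in>UNIV. (norm (rcd_step A i x))\<^sup>2) / real CARD('n)
      \<le> (1 - 2 * \<mu> / real CARD('n) + \<mu>\<^sup>2 / real CARD('n)) * (norm x)\<^sup>2" for x
  proof -
    have "(\<Sum>i\<in>UNIV. (norm (rcd_step A i x))\<^sup>2)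
        = (real CARD('n) - 1) * (x \<bullet> x) + (norm (x - A *v x))\<^sup>2"
      unfolding sum_norm_sq_rcd_step[OF diag, folded assms(4)]
      by (simp add: power2_norm_eq_inner inner_diff_left inner_diff_right inner_commute
          algebra_simps)
    also have "\<dots> \<le> (real CARD('n) - 1) * (x \<bullet> x) + (1 - \<mu>)\<^sup>2 * (norm x)\<^sup>2"
      using norm_sq_residual_hessian_le[OF assms(1), of x \<alpha>] by (simp add: assms(4,6))
    also have "\<dots> = (real CARD('n) - 2 * \<mu> + \<mu>\<^sup>2) * (norm x)\<^sup>2"
      by (simp add: power2_norm_eq_inner power2_diff algebra_simps)
    finally show ?thesis
      using n by (simp add: field_simps)
  qed
  have step2: "(\<Sum>i\<in>UNIV. f (rcd_step A i x)) / real CARD('n)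
      \<le> (1 - \<mu> / real CARD('n)) * f x" for x
  proof -
    have "(\<Sum>i\<in>UNIV. f (rcd_step A i x)) = real CARD('n) * f x - (norm (A *v x))\<^sup>2 / 2"
      unfolding assms(4,5) by (rule sum_quad_rcd_step[OF transpose_hessian diag])
    also have "\<dots> \<le> real CARD('n) * f x - \<mu> * f x"
      using gradient_domination_hessian[OF order.strict_implies_order[OF assms(2)], of x]
      by (simp add: assms(4-6) quad_def)
    finally show ?thesis
      using n by (simp add: field_simps)
  qed
  have "f xstar = 0"
    by (simp add: assms(5,7) quad_def)
  then show ?thesis
    using expectation_rcd_le[OF assms(9,10) rate1 step1, of x0 k]
      expectation_rcd_le[OF assms(9,10) rate2 step2, of x0 k]
    by (simp add: assms(7))
qed

end
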